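(* Let $K\ge 2$ be an integer and let $\mathcal{X}=\{x_1,\ldots,x_N\}$ be a finite collection of positive real numbers sorted so that $x_1\le\cdots\le x_N$. The following algorithm can be implemented to run in $O(N\log N)$ time: (1) Set $\mathcal{X}_1=\mathcal{X}$, $\mathcal{X}_k=\emptyset$ for $2\le k\le K$, $\mathcal{K}=\{1,\ldots,K\}$; $S_k=\sum_{x\in\mathcal{X}_k}x$ denotes the current set sums. (2) If $|\mathcal{K}|=1$, stop. (3) Let $i\in\mathcal{K}$ index a set with the largest sum among the sets indexed by $\mathcal{K}$. (4) Let $j\in\arg\min_k S_k$. (5) Let $\mathcal{X}_*=\{x\in\mathcal{X}_i:|(S_i-x)-(S_j+x)|<|S_i-S_j|\}$. (6) If $\mathcal{X}_*=\emptyset$, set $\mathcal{K}\leftarrow\mathcal{K}\setminus\{i\}$ and go to (2); otherwise let $x_*=\max\mathcal{X}_*$. (7) Move $x_*$ from $\mathcal{X}_i$ to $\mathcal{X}_j$, update sums, go to (2). *)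

theory Defs
  imports Complex_Main "HOL-Library.Multiset" "HOL-Library.Landau_Symbols"
begin

section \<open>The partitioning algorithm\<close>

text \<open>
  A state consists of the sets \<open>X\<^sub>1, \<dots>, X\<^sub>K\<close> (multisets, because the given numbers need not be
  distinct) and the index set called \<open>I\<close> here.  Values of the first component outside
  \<open>{1..K}\<close> are irrelevant.
\<close>

type_synonym state = "(nat \<Rightarrow> real multiset) \<times> nat set"

definition set_sum :: "(nat \<Rightarrow> real multiset) \<Rightarrow> nat \<Rightarrow> real" where
  "set_sum X k = (\<Sum>x\<in>#X k. x)"

definition improving :: "(nat \<Rightarrow> real multiset) \<Rightarrow> nat \<Rightarrow> nat \<Rightarrow> real set" where
  "improving X i j =
     {x. x \<in># X i \<and>
         \<bar>(set_sum X i - x) - (set_sum X j + x)\<bar> < \<bar>set_sum X i - set_sum X j\<bar>}"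

definition init_state :: "nat \<Rightarrow> real list \<Rightarrow> state" where
  "init_state K xs = ((\<lambda>k. if k = 1 then mset xs else {#}), {1..K})"

definition stopped :: "state \<Rightarrow> bool" where
  "stopped s \<longleftrightarrow> card (snd s) = 1"

text \<open>
  One pass through the loop body.  Ties for the largest and for the smallest sum are left open,
  hence a relation.  The smallest sum is taken over all \<open>K\<close> sets, the largest one only over the
  sets indexed by \<open>I\<close>.
\<close>

inductive alg_step :: "nat \<Rightarrow> state \<Rightarrow> state \<Rightarrow> bool" for K :: nat where
  discard:
    "\<lbrakk> \<not> stopped (X, I);
       is_arg_max (set_sum X) (\<lambda>k. k \<in> I) i;
       is_arg_min (set_sum X) (\<lambda>k. k \<in> {1..K}) j;
       improving X i j = {} \<rbrakk>
     \<Longrightarrow> alg_step K (X, I) (X, I - {i})"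
| move:
    "\<lbrakk> \<not> stopped (X, I);
       is_arg_max (set_sum X) (\<lambda>k. k \<in> I) i;
       is_arg_min (set_sum X) (\<lambda>k. k \<in> {1..K}) j;
       improving X i j \<noteq> {};
       x = Max (improving X i j) \<rbrakk>
     \<Longrightarrow> alg_step K (X, I) (X(i := X i - {#x#}, j := add_mset x (X j)), I)"


section \<open>Real RAM\<close>

text \<open>
  The usual uniform-cost real RAM: integer registers and arrays used for counting and addressing
  (with addition and truncated subtraction only), real registers and arrays with exact field
  operations and comparisons, and no conversion from reals to integers.  A program has finitely
  many instructions and therefore uses finitely many registers and arrays; array names are
  static, array indices are taken from integer registers.  Jump targets are absolute positions
  in the program, and leaving the program means halting.
\<close>

datatype instr =
    IConst nat nat          \<comment> \<open>target, constant\<close>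
  | ICopy nat nat
  | IAdd nat nat nat        \<comment> \<open>target, operands\<close>
  | ISub nat nat nat
  | ILoad nat nat nat       \<comment> \<open>target, array, index register\<close>
  | IStore nat nat nat      \<comment> \<open>array, index register, source\<close>
  | RConst nat int
  | RCopy nat nat
  | RAdd nat nat nat
  | RSub nat nat nat
  | RMul nat nat nat
  | RDiv nat nat nat
  | RLoad nat nat nat
  | RStore nat nat nat
  | Jump nat
  | IJumpLess nat nat nat   \<comment> \<open>compared registers, jump target\<close>
  | IJumpEq nat nat nat
  | RJumpLess nat nat nat
  | RJumpEq nat nat nat

type_synonym program = "instr list"

record config =
  pc :: nat
  ireg :: "nat \<Rightarrow> nat"
  rreg :: "nat \<Rightarrow> real"
  iarr :: "nat \<Rightarrow> nat \<Rightarrow> nat"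
  rarr :: "nat \<Rightarrow> nat \<Rightarrow> real"

definition next_pc :: "config \<Rightarrow> config" where
  "next_pc c = c\<lparr>pc := Suc (pc c)\<rparr>"

definition set_ireg :: "nat \<Rightarrow> nat \<Rightarrow> config \<Rightarrow> config" where
  "set_ireg r v c = c\<lparr>ireg := (ireg c)(r := v)\<rparr>"

definition set_rreg :: "nat \<Rightarrow> real \<Rightarrow> config \<Rightarrow> config" where
  "set_rreg r v c = c\<lparr>rreg := (rreg c)(r := v)\<rparr>"

definition set_iarr :: "nat \<Rightarrow> nat \<Rightarrow> nat \<Rightarrow> config \<Rightarrow> config" where
  "set_iarr a p v c = c\<lparr>iarr := (iarr c)(a := (iarr c a)(p := v))\<rparr>"

definition set_rarr :: "nat \<Rightarrow> nat \<Rightarrow> real \<Rightarrow> config \<Rightarrow> config" where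
  "set_rarr a p v c = c\<lparr>rarr := (rarr c)(a := (rarr c a)(p := v))\<rparr>"

definition jump_if :: "bool \<Rightarrow> nat \<Rightarrow> config \<Rightarrow> config" where
  "jump_if b l c = (if b then c\<lparr>pc := l\<rparr> else next_pc c)"

fun exec_instr :: "instr \<Rightarrow> config \<Rightarrow> config" where
  "exec_instr (IConst r n) c = next_pc (set_ireg r n c)"
| "exec_instr (ICopy r a) c = next_pc (set_ireg r (ireg c a) c)"
| "exec_instr (IAdd r a b) c = next_pc (set_ireg r (ireg c a + ireg c b) c)"
| "exec_instr (ISub r a b) c = next_pc (set_ireg r (ireg c a - ireg c b) c)"
| "exec_instr (ILoad r A p) c = next_pc (set_ireg r (iarr c A (ireg c p)) c)"
| "exec_instr (IStore A p a) c = next_pc (set_iarr A (ireg c p) (ireg c a) c)"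
| "exec_instr (RConst r z) c = next_pc (set_rreg r (of_int z) c)"
| "exec_instr (RCopy r a) c = next_pc (set_rreg r (rreg c a) c)"
| "exec_instr (RAdd r a b) c = next_pc (set_rreg r (rreg c a + rreg c b) c)"
| "exec_instr (RSub r a b) c = next_pc (set_rreg r (rreg c a - rreg c b) c)"
| "exec_instr (RMul r a b) c = next_pc (set_rreg r (rreg c a * rreg c b) c)"
| "exec_instr (RDiv r a b) c = next_pc (set_rreg r (rreg c a / rreg c b) c)"
| "exec_instr (RLoad r A p) c = next_pc (set_rreg r (rarr c A (ireg c p)) c)"
| "exec_instr (RStore A p a) c = next_pc (set_rarr A (ireg c p) (rreg c a) c)"
| "exec_instr (Jump l) c = c\<lparr>pc := l\<rparr>"
| "exec_instr (IJumpLess a b l) c = jump_if (ireg c a < ireg c b) l c"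
| "exec_instr (IJumpEq a b l) c = jump_if (ireg c a = ireg c b) l c"
| "exec_instr (RJumpLess a b l) c = jump_if (rreg c a < rreg c b) l c"
| "exec_instr (RJumpEq a b l) c = jump_if (rreg c a = rreg c b) l c"

definition halted :: "program \<Rightarrow> config \<Rightarrow> bool" where
  "halted P c \<longleftrightarrow> length P \<le> pc c"

definition ram_step :: "program \<Rightarrow> config \<Rightarrow> config" where
  "ram_step P c = (if halted P c then c else exec_instr (P ! pc c) c)"

text \<open>
  The input: \<open>N\<close> in integer register 0, the numbers \<open>x\<^sub>1, \<dots>, x\<^sub>N\<close> in cells \<open>0, \<dots>, N - 1\<close> of real
  array 0, everything else zero.
\<close>

definition init_config :: "real list \<Rightarrow> config" where
  "init_config xs =
     \<lparr>pc = 0,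
      ireg = (\<lambda>_. 0)(0 := length xs),
      rreg = (\<lambda>_. 0),
      iarr = (\<lambda>_ _. 0),
      rarr = (\<lambda>_ _. 0)(0 := (\<lambda>p. if p < length xs then xs ! p else 0))\<rparr>"

definition config_at :: "program \<Rightarrow> real list \<Rightarrow> nat \<Rightarrow> config" where
  "config_at P xs t = (ram_step P ^^ t) (init_config xs)"


section \<open>Implementations and their running time\<close>

text \<open>
  How a state of the algorithm is laid out in memory: cell \<open>p\<close> of integer array 0 holds the index
  of the set containing the \<open>p\<close>-th input number, integer array 1 is the characteristic
  function of \<open>I\<close>, and real array 1 holds the current set sums.  A program may use all other
  registers and arrays freely for further data structures.
\<close>

definition represents :: "nat \<Rightarrow> real list \<Rightarrow> config \<Rightarrow> state \<Rightarrow> bool" where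
  "represents K xs c s \<longleftrightarrow>
     (\<forall>p < length xs. iarr c 0 p \<in> {1..K}) \<and>
     (\<forall>k \<in> {1..K}. fst s k = image_mset (\<lambda>p. xs ! p) (mset_set {p. p < length xs \<and> iarr c 0 p = k})) \<and>
     (\<forall>k \<in> {1..K}. iarr c 1 k = (if k \<in> snd s then 1 else 0)) \<and>
     (\<forall>k \<in> {1..K}. rarr c 1 k = set_sum (fst s) k)"

text \<open>
  On input \<open>xs\<close> the program carries out the algorithm within \<open>t\<close> instructions: there is a complete
  run \<open>\<sigma> 0, \<dots>, \<sigma> m\<close> of the algorithm whose states appear in memory, in this order, at times
  \<open>\<tau> 0 < \<dots> < \<tau> m \<le> t\<close>, and the program has halted at time \<open>\<tau> m\<close>.
\<close>

definition implements_within :: "program \<Rightarrow> nat \<Rightarrow> real list \<Rightarrow> nat \<Rightarrow> bool" where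
  "implements_within P K xs t \<longleftrightarrow>
     (\<exists>(m::nat) \<sigma> \<tau>.
        \<sigma> 0 = init_state K xs \<and>
        (\<forall>r < m. alg_step K (\<sigma> r) (\<sigma> (Suc r))) \<and>
        stopped (\<sigma> m) \<and>
        (\<forall>r < m. \<tau> r < \<tau> (Suc r)) \<and>
        (\<forall>r \<le> m. represents K xs (config_at P xs (\<tau> r)) (\<sigma> r)) \<and>
        halted P (config_at P xs (\<tau> m)) \<and>
        \<tau> m \<le> t)"

end

theory Submission
  imports Defs "HOL-Real_Asymp.Real_Asymp"
begin

text \<open>
  For positive numbers, an item \<open>x\<close> of set \<open>i\<close> is improving iff \<open>x < S\<^sub>i - S\<^sub>j\<close>.  Suppose all moves
  so far started from set 1.  The gap \<open>S\<^sub>1 - min S\<close> never increases, so the items were moved in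
  nonincreasing order.  Hence, for \<open>k \<noteq> 1\<close>, the item \<open>x\<close> that entered set \<open>k\<close> last is its smallest
  one, and \<open>S\<^sub>k - x\<close> was the minimal sum at that time.  As the minimal sum never decreases,
  \<open>S\<^sub>k - min S \<le> x\<close> from then on, so set \<open>k\<close> has no improving item and is discarded as soon as
  it is selected.  All moves therefore start from set 1, and the candidate item is found by one
  pointer running downwards through the sorted input.  As \<open>K\<close> is constant, this takes
  time \<open>O(N)\<close>.
\<close>

declare One_nat_def [simp del]

section \<open>The algorithm on index assignments\<close>

definition positions :: "real list \<Rightarrow> (nat \<Rightarrow> nat) \<Rightarrow> nat \<Rightarrow> nat set" where
  "positions xs a k = {q. q < length xs \<and> a q = k}"

definition items :: "real list \<Rightarrow> (nat \<Rightarrow> nat) \<Rightarrow> nat \<Rightarrow> real multiset" where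
  "items xs a k = image_mset ((!) xs) (mset_set (positions xs a k))"

definition load :: "real list \<Rightarrow> (nat \<Rightarrow> nat) \<Rightarrow> nat \<Rightarrow> real" where
  "load xs a k = (\<Sum>q\<in>positions xs a k. xs ! q)"

definition initial_assignment :: "real list \<Rightarrow> nat \<Rightarrow> nat" where
  "initial_assignment xs q = (if q < length xs then 1 else 0)"

lemma finite_positions [simp]: "finite (positions xs a k)"
  by (simp add: positions_def)

lemma set_mset_items [simp]: "set_mset (items xs a k) = (!) xs ` positions xs a k"
  by (simp add: items_def)

lemma set_sum_items [simp]: "set_sum (items xs a) = load xs a"
  by (simp add: fun_eq_iff set_sum_def items_def load_def sum_unfold_sum_mset)

lemma load_nonneg:
  assumes "\<And>x. x \<in> set xs \<Longrightarrow> 0 \<le> x"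
  shows "0 \<le> load xs a k"
  using assms by (auto simp: load_def positions_def intro!: sum_nonneg)

lemma positions_const:
  assumes "\<forall>q<length xs. a q = i"
  shows "positions xs a k = (if k = i then {..<length xs} else {})"
  using assms by (auto simp: positions_def)

lemma items_const:
  assumes "\<forall>q<length xs. a q = i"
  shows "items xs a = (\<lambda>k. if k = i then mset xs else {#})"
proof -
  have "image_mset ((!) xs) (mset_set {..<length xs}) = mset (map ((!) xs) [0..<length xs])"
    by (simp add: lessThan_atLeast0)
  then show ?thesis
    by (simp add: fun_eq_iff items_def positions_const[OF assms] map_nth)
qed

lemma load_const:
  assumes "\<forall>q<length xs. a q = i"
  shows "load xs a = (\<lambda>k. if k = i then \<Sum>q<length xs. xs ! q else 0)"
  by (simp add: fun_eq_iff load_def positions_const[OF assms])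

lemma positions_update:
  assumes "p < length xs" "a p \<noteq> j"
  shows "positions xs (a(p := j)) =
    (positions xs a)(a p := positions xs a (a p) - {p}, j := insert p (positions xs a j))"
  using assms by (auto simp: fun_eq_iff positions_def)

lemma items_update:
  assumes "p < length xs" "a p \<noteq> j"
  shows "items xs (a(p := j)) =
    (items xs a)(a p := items xs a (a p) - {#xs ! p#}, j := add_mset (xs ! p) (items xs a j))"
proof -
  have "{p} \<subseteq> positions xs a (a p)" "p \<notin> positions xs a j"
    using assms by (auto simp: positions_def)
  then show ?thesis
    by (auto simp: fun_eq_iff items_def positions_update[of p xs a j, OF assms]
        mset_set_Diff image_mset_Diff)
qed

lemma load_update:
  assumes "p < length xs" "a p \<noteq> j"
  shows "load xs (a(p := j)) =
    (load xs a)(a p := load xs a (a p) - xs ! p, j := load xs a j + xs ! p)"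
proof -
  have "p \<in> positions xs a (a p)" "p \<notin> positions xs a j"
    using assms by (auto simp: positions_def)
  then show ?thesis
    by (auto simp: fun_eq_iff load_def positions_update[of p xs a j, OF assms] sum_diff1)
qed

lemma improving_iff:
  assumes "set_sum X j \<le> set_sum X i" "\<forall>y\<in>#X i. 0 < y"
  shows "x \<in> improving X i j \<longleftrightarrow> x \<in># X i \<and> x < set_sum X i - set_sum X j"
  using assms by (auto simp: improving_def abs_if)

section \<open>Settled items\<close>

text \<open>No move of item \<open>q\<close> can improve, whatever the target.\<close>

definition settled :: "nat \<Rightarrow> real list \<Rightarrow> (nat \<Rightarrow> nat) \<Rightarrow> nat \<Rightarrow> bool" where
  "settled K xs a q \<longleftrightarrow> (\<forall>l\<in>{1..K}. load xs a (a q) - xs ! q \<le> load xs a l)"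

definition frontier :: "nat \<Rightarrow> real list \<Rightarrow> (nat \<Rightarrow> nat) \<Rightarrow> nat \<Rightarrow> bool" where
  "frontier K xs a p \<longleftrightarrow>
     p \<le> length xs \<and> (\<forall>q<length xs. a q \<in> {1..K}) \<and> (\<forall>q<p. a q = 1) \<and>
     (\<forall>q\<in>{p..<length xs}. settled K xs a q)"

abbreviation largest :: "(nat \<Rightarrow> real) \<Rightarrow> nat set \<Rightarrow> nat \<Rightarrow> bool" where
  "largest S I \<equiv> is_arg_max S (\<lambda>k. k \<in> I)"

abbreviation smallest :: "(nat \<Rightarrow> real) \<Rightarrow> nat set \<Rightarrow> nat \<Rightarrow> bool" where
  "smallest S I \<equiv> is_arg_min S (\<lambda>k. k \<in> I)"

lemma settled_iff_smallest:
  assumes "smallest (load xs a) {1..K} j"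
  shows "settled K xs a q \<longleftrightarrow> load xs a (a q) - load xs a j \<le> xs ! q"
  using assms by (force simp: settled_def is_arg_min_linorder)

lemma smallest_load_le_update:
  assumes "smallest (load xs a) {1..K} j" "p < length xs" "0 < xs ! p"
    and "xs ! p < load xs a (a p) - load xs a j" "l \<in> {1..K}"
  shows "load xs a j \<le> load xs (a(p := j)) l"
proof -
  have "a p \<noteq> j"
    using assms(3,4) by auto
  moreover have "load xs a j \<le> load xs a l"
    using assms(1,5) by (simp add: is_arg_min_linorder)
  ultimately show ?thesis
    using assms(2-4) by (simp add: load_update)
qed

text \<open>
  The moved item \<open>p\<close> is settled because set \<open>j\<close> was a smallest one just before, and the items
  already in set \<open>j\<close> stay settled because they are at least as large as \<open>p\<close>.
\<close>

lemma settled_update: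
  assumes "smallest (load xs a) {1..K} j" "p < length xs" "0 < xs ! p" "xs ! p \<le> xs ! q"
    and gap: "xs ! p < load xs a (a p) - load xs a j"
    and "q = p \<or> settled K xs a q"
  shows "settled K xs (a(p := j)) q"
  unfolding settled_def
proof
  fix l
  assume "l \<in> {1..K}"
  have "a p \<noteq> j"
    using assms(3) gap by auto
  note load' = load_update[of p xs a j, OF \<open>p < length xs\<close> this]
  have "load xs (a(p := j)) ((a(p := j)) q) - xs ! q \<le> load xs a j"
  proof (cases "(a(p := j)) q = j")
    case True
    then show ?thesis
      using assms(4) by (simp add: load')
  next
    case False
    then have "q \<noteq> p" "a q \<noteq> j"
      by (simp_all split: if_splits)
    then have "load xs a (a q) - xs ! q \<le> load xs a j"
      using assms(6) settled_iff_smallest[OF assms(1)] by (simp add: algebra_simps)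
    then show ?thesis
      using \<open>q \<noteq> p\<close> \<open>a q \<noteq> j\<close> assms(3) by (auto simp: load')
  qed
  also have "\<dots> \<le> load xs (a(p := j)) l"
    using smallest_load_le_update[OF assms(1-3) gap \<open>l \<in> {1..K}\<close>] .
  finally show "load xs (a(p := j)) ((a(p := j)) q) - xs ! q \<le> load xs (a(p := j)) l" .
qed

lemma frontier_length:
  assumes "1 \<le> K" "\<forall>q<length xs. a q = 1"
  shows "frontier K xs a (length xs)"
  using assms by (simp add: frontier_def)

lemma frontier_skip:
  assumes "frontier K xs a (Suc p)" "settled K xs a p"
  shows "frontier K xs a p"
  using assms by (auto simp: frontier_def Suc_le_eq dest: le_imp_less_or_eq)

lemma frontier_settled_0:
  assumes "frontier K xs a 0" "q \<in> positions xs a i"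
  shows "settled K xs a q"
  using assms by (simp add: frontier_def positions_def)

lemma frontier_settled_other:
  assumes "frontier K xs a p" "q \<in> positions xs a i" "i \<noteq> 1"
  shows "settled K xs a q"
  using assms by (force simp: frontier_def positions_def not_less[symmetric])

locale sorted_input =
  fixes K :: nat and xs :: "real list"
  assumes sorted: "sorted xs" and pos: "x \<in> set xs \<Longrightarrow> 0 < x"
begin

lemma nth_pos: "q < length xs \<Longrightarrow> 0 < xs ! q"
  by (simp add: pos)

lemma frontier_move:
  assumes "frontier K xs a (Suc p)" "smallest (load xs a) {1..K} j"
    and "xs ! p < load xs a 1 - load xs a j"
  shows "frontier K xs (a(p := j)) p"
proof -
  have p: "p < length xs" "a p = 1"
    using assms(1) by (simp_all add: frontier_def)
  have "settled K xs (a(p := j)) q" if q: "p \<le> q" "q < length xs" for q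
  proof (rule settled_update[OF assms(2) p(1) nth_pos])
    show "xs ! p \<le> xs ! q"
      using sorted q by (rule sorted_nth_mono)
    show "q = p \<or> settled K xs a q"
      using assms(1) q by (auto simp: frontier_def Suc_le_eq dest: le_imp_less_or_eq)
  qed (use p assms(3) in simp_all)
  then show ?thesis
    using assms(1,2) by (simp add: frontier_def is_arg_min_def)
qed

lemma improving_items_iff:
  assumes "load xs a j \<le> load xs a i"
  shows "x \<in> improving (items xs a) i j \<longleftrightarrow>
    (\<exists>q\<in>positions xs a i. x = xs ! q \<and> xs ! q < load xs a i - load xs a j)"
proof -
  have "\<forall>y\<in>#items xs a i. 0 < y"
    by (auto simp: positions_def nth_pos)
  then show ?thesis
    using improving_iff[of "items xs a" j i x] assms by auto
qed

lemma alg_step_discard: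
  assumes "card I \<noteq> 1" "I \<subseteq> {1..K}"
    and i: "largest (load xs a) I i" and j: "smallest (load xs a) {1..K} j"
    and settled: "\<forall>q\<in>positions xs a i. settled K xs a q"
  shows "alg_step K (items xs a, I) (items xs a, I - {i})"
proof (rule alg_step.discard)
  have "load xs a j \<le> load xs a i"
    using i j \<open>I \<subseteq> {1..K}\<close> by (auto simp: is_arg_max_def is_arg_min_linorder)
  moreover have "load xs a i - load xs a j \<le> xs ! q" if "q \<in> positions xs a i" for q
    using settled_iff_smallest[OF j, of q] settled that by (auto simp: positions_def)
  ultimately show "improving (items xs a) i j = {}"
    using improving_items_iff by (meson ex_in_conv not_less)
qed (use assms in \<open>simp_all add: stopped_def\<close>)

lemma Max_improving_frontier:
  assumes frontier: "frontier K xs a (Suc p)" and j: "smallest (load xs a) {1..K} j"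
    and gap: "xs ! p < load xs a 1 - load xs a j"
  shows "improving (items xs a) 1 j \<noteq> {}" "Max (improving (items xs a) 1 j) = xs ! p"
proof -
  have p: "p < length xs" "a p = 1"
    using frontier by (simp_all add: frontier_def)
  have "load xs a j \<le> load xs a 1"
    using nth_pos[OF p(1)] gap by linarith
  note iff = improving_items_iff[OF this]
  have mem: "xs ! p \<in> improving (items xs a) 1 j"
    using p gap by (auto simp: iff positions_def)
  then show "improving (items xs a) 1 j \<noteq> {}"
    by blast
  have upper: "x \<le> xs ! p" if x: "x \<in> improving (items xs a) 1 j" for x
  proof -
    obtain q where q: "q \<in> positions xs a 1" "x = xs ! q" "xs ! q < load xs a 1 - load xs a j"
      using x by (auto simp: iff)
    then have "\<not> settled K xs a q"
      by (simp add: settled_iff_smallest[OF j] positions_def)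
    then have "q \<le> p"
      using frontier q(1) by (auto simp: frontier_def positions_def not_less_eq_eq[symmetric])
    then show ?thesis
      using sorted p(1) q(2) by (simp add: sorted_nth_mono)
  qed
  have "finite (improving (items xs a) 1 j)"
    by (rule finite_subset[of _ "set_mset (items xs a 1)"]) (auto simp: improving_def)
  then show "Max (improving (items xs a) 1 j) = xs ! p"
    using upper mem by (rule Max_eqI)
qed

lemma alg_step_move:
  assumes "card I \<noteq> 1" "largest (load xs a) I 1" and j: "smallest (load xs a) {1..K} j"
    and frontier: "frontier K xs a (Suc p)" and gap: "xs ! p < load xs a 1 - load xs a j"
  shows "alg_step K (items xs a, I) (items xs (a(p := j)), I)"
proof -
  have p: "p < length xs" "a p = 1"
    using frontier by (simp_all add: frontier_def)
  moreover have "j \<noteq> 1"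
    using nth_pos[OF p(1)] gap by auto
  ultimately show ?thesis
    using assms(1-3) Max_improving_frontier[OF frontier j gap]
    by (auto simp: stopped_def items_update intro: alg_step.move)
qed

end

section \<open>Running programs\<close>

definition run :: "program \<Rightarrow> nat \<Rightarrow> config \<Rightarrow> config" where
  "run P t c = (ram_step P ^^ t) c"

lemma run_0 [simp]: "run P 0 c = c"
  by (simp add: run_def)

lemma run_Suc [simp]:
  "pc c < length P \<Longrightarrow> run P (Suc t) c = run P t (exec_instr (P ! pc c) c)"
  by (simp add: run_def funpow_swap1 ram_step_def halted_def)

lemma run_1 [simp]: "pc c < length P \<Longrightarrow> run P 1 c = exec_instr (P ! pc c) c"
  by (simp add: One_nat_def)

lemma run_numeral [simp]:
  "pc c < length P \<Longrightarrow> run P (numeral n) c = run P (pred_numeral n) (exec_instr (P ! pc c) c)"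
  by (simp add: numeral_eq_Suc)

lemma run_add: "run P (t + u) c = run P u (run P t c)"
  by (metis run_def add.commute comp_apply funpow_add)

definition completes_within ::
  "program \<Rightarrow> nat \<Rightarrow> real list \<Rightarrow> state \<Rightarrow> config \<Rightarrow> nat \<Rightarrow> bool" where
  "completes_within P K xs s c t \<longleftrightarrow>
     (\<exists>(m::nat) \<sigma> \<tau>.
        \<sigma> 0 = s \<and> (\<forall>r<m. alg_step K (\<sigma> r) (\<sigma> (Suc r))) \<and> stopped (\<sigma> m) \<and>
        (\<forall>r<m. \<tau> r < \<tau> (Suc r)) \<and> (\<forall>r\<le>m. represents K xs (run P (\<tau> r) c) (\<sigma> r)) \<and>
        halted P (run P (\<tau> m) c) \<and> \<tau> m \<le> t)"

lemma implements_within_iff_completes_within: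
  "implements_within P K xs t \<longleftrightarrow> completes_within P K xs (init_state K xs) (init_config xs) t"
  by (simp add: implements_within_def completes_within_def config_at_def run_def)

lemma completes_within_stopped:
  assumes "stopped s" "represents K xs (run P t c) s" "halted P (run P t c)" "t \<le> u"
  shows "completes_within P K xs s c u"
  unfolding completes_within_def
  by (rule exI[of _ 0], rule exI[of _ "\<lambda>_. s"], rule exI[of _ "\<lambda>_. t"]) (use assms in simp)

lemma completes_within_delay:
  assumes "completes_within P K xs s (run P t c) u"
  shows "completes_within P K xs s c (t + u)"
proof -
  obtain m \<sigma> \<tau> where "\<sigma> 0 = s" "\<forall>r<m. alg_step K (\<sigma> r) (\<sigma> (Suc r))" "stopped (\<sigma> m)"
    "\<forall>r<m. \<tau> r < \<tau> (Suc r)" "\<forall>r\<le>m. represents K xs (run P (\<tau> r) (run P t c)) (\<sigma> r)"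
    "halted P (run P (\<tau> m) (run P t c))" "\<tau> m \<le> u"
    using assms unfolding completes_within_def by blast
  then show ?thesis
    unfolding completes_within_def
    by (intro exI[of _ m] exI[of _ \<sigma>] exI[of _ "\<lambda>r. t + \<tau> r"]) (simp add: run_add)
qed

lemma completes_within_step:
  assumes "alg_step K s s'" "represents K xs c s" "0 < t" "t + u \<le> v"
    and "completes_within P K xs s' (run P t c) u"
  shows "completes_within P K xs s c v"
proof -
  obtain m \<sigma> \<tau> where tail: "\<sigma> 0 = s'" "\<forall>r<m. alg_step K (\<sigma> r) (\<sigma> (Suc r))" "stopped (\<sigma> m)"
    "\<forall>r<m. \<tau> r < \<tau> (Suc r)" "\<forall>r\<le>m. represents K xs (run P (\<tau> r) (run P t c)) (\<sigma> r)"
    "halted P (run P (\<tau> m) (run P t c))" "\<tau> m \<le> u"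
    using assms(5) unfolding completes_within_def by blast
  define \<sigma>' \<tau>' where "\<sigma>' = case_nat s \<sigma>" and "\<tau>' = case_nat 0 (\<lambda>r. t + \<tau> r)"
  have "alg_step K (\<sigma>' r) (\<sigma>' (Suc r))" "\<tau>' r < \<tau>' (Suc r)" if "r < Suc m" for r
    using that tail assms(1,3) by (cases r; simp add: \<sigma>'_def \<tau>'_def)+
  moreover have "represents K xs (run P (\<tau>' r) c) (\<sigma>' r)" if "r \<le> Suc m" for r
    using that tail assms(2) by (cases r) (simp_all add: \<sigma>'_def \<tau>'_def run_add)
  moreover have "\<sigma>' 0 = s" "stopped (\<sigma>' (Suc m))" "\<tau>' (Suc m) \<le> v"
    "halted P (run P (\<tau>' (Suc m)) c)"
    using tail assms(4) by (simp_all add: \<sigma>'_def \<tau>'_def run_add)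
  ultimately show ?thesis
    unfolding completes_within_def by blast
qed

lemma completes_within_potential:
  fixes \<Phi> :: "config \<Rightarrow> nat"
  assumes rep: "\<And>s c. R s c \<Longrightarrow> represents K xs c s"
    and stop: "\<And>s c. R s c \<Longrightarrow> stopped s \<Longrightarrow>
      \<exists>t\<le>\<Phi> c. represents K xs (run P t c) s \<and> halted P (run P t c)"
    and step: "\<And>s c. R s c \<Longrightarrow> \<not> stopped s \<Longrightarrow>
      \<exists>t c' s'. run P t c = c' \<and> alg_step K s s' \<and> R s' c' \<and> \<Phi> c' < \<Phi> c \<and> t + \<Phi> c' \<le> \<Phi> c"
    and "R s c"
  shows "completes_within P K xs s c (\<Phi> c)"
  using \<open>R s c\<close>
proof (induction "\<Phi> c" arbitrary: s c rule: less_induct)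
  case less
  show ?case
  proof (cases "stopped s")
    case True
    then show ?thesis
      using stop[OF less.prems] completes_within_stopped[OF True] by blast
  next
    case False
    then obtain t c' s' where t: "run P t c = c'" and "alg_step K s s'" "R s' c'"
      and \<Phi>: "\<Phi> c' < \<Phi> c" "t + \<Phi> c' \<le> \<Phi> c"
      using step[OF less.prems] by blast
    have "0 < t"
      using t \<Phi>(1) by (cases t) auto
    moreover have "completes_within P K xs s' (run P t c) (\<Phi> c')"
      unfolding t using \<Phi>(1) \<open>R s' c'\<close> by (rule less.hyps)
    ultimately show ?thesis
      using completes_within_step[OF \<open>alg_step K s s'\<close> rep[OF less.prems] _ \<Phi>(2)] by blast
  qed
qed

section \<open>The program\<close>

text \<open>
  \<open>pointer_r\<close> holds the pointer of \<^const>\<open>frontier\<close>, and \<open>source_r\<close> and \<open>target_r\<close> hold the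
  selected indices \<open>i\<close> and \<open>j\<close>.
\<close>

abbreviation (input) "size_r \<equiv> 0 :: nat"
abbreviation (input) "one_r \<equiv> 1 :: nat"
abbreviation (input) "sets_r \<equiv> 2 :: nat"
abbreviation (input) "pointer_r \<equiv> 3 :: nat"
abbreviation (input) "card_r \<equiv> 4 :: nat"
abbreviation (input) "source_r \<equiv> 5 :: nat"
abbreviation (input) "target_r \<equiv> 6 :: nat"
abbreviation (input) "count_r \<equiv> 7 :: nat"
abbreviation (input) "flag_r \<equiv> 8 :: nat"
abbreviation (input) "zero_r \<equiv> 9 :: nat"

abbreviation (input) "source_sum_r \<equiv> 1 :: nat"
abbreviation (input) "target_sum_r \<equiv> 2 :: nat"
abbreviation (input) "gap_r \<equiv> 3 :: nat"
abbreviation (input) "value_r \<equiv> 4 :: nat"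

abbreviation (input) "set_of_item \<equiv> 0 :: nat"
abbreviation (input) "in_index_set \<equiv> 1 :: nat"
abbreviation (input) "item_values \<equiv> 0 :: nat"
abbreviation (input) "set_sums \<equiv> 1 :: nat"

abbreviation (input) "item_loop_pc \<equiv> 4 :: nat"
abbreviation (input) "store_sum_pc \<equiv> 10 :: nat"
abbreviation (input) "index_loop_pc \<equiv> 12 :: nat"
abbreviation (input) "store_card_pc \<equiv> 16 :: nat"
abbreviation (input) "main_pc \<equiv> 17 :: nat"
abbreviation (input) "select_pc \<equiv> 22 :: nat"
abbreviation (input) "compare_max_pc \<equiv> 27 :: nat"
abbreviation (input) "next_set_pc \<equiv> 32 :: nat"
abbreviation (input) "selected_pc \<equiv> 34 :: nat"
abbreviation (input) "discard_pc \<equiv> 35 :: nat"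
abbreviation (input) "gap_pc \<equiv> 38 :: nat"
abbreviation (input) "scan_pc \<equiv> 39 :: nat"
abbreviation (input) "move_pc \<equiv> 44 :: nat"
abbreviation (input) "halt_pc \<equiv> 50 :: nat"

definition prog :: "nat \<Rightarrow> program" where
  "prog K =
    [IConst one_r 1,
     IConst sets_r K,
     ICopy pointer_r size_r,
     ICopy count_r size_r,
     \<comment> \<open>\<open>item_loop_pc\<close> = 4\<close>
     IJumpEq count_r zero_r store_sum_pc,
     ISub count_r count_r one_r,
     RLoad value_r item_values count_r,
     RAdd source_sum_r source_sum_r value_r,
     IStore set_of_item count_r one_r,
     Jump item_loop_pc,
     \<comment> \<open>\<open>store_sum_pc\<close> = 10\<close>
     RStore set_sums one_r source_sum_r,
     ICopy count_r sets_r,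
     \<comment> \<open>\<open>index_loop_pc\<close> = 12\<close>
     IJumpEq count_r zero_r store_card_pc,
     IStore in_index_set count_r one_r,
     ISub count_r count_r one_r,
     Jump index_loop_pc,
     \<comment> \<open>\<open>store_card_pc\<close> = 16\<close>
     ICopy card_r sets_r,
     \<comment> \<open>\<open>main_pc\<close> = 17\<close>
     IJumpEq card_r one_r halt_pc,
     RConst source_sum_r (- 1),
     RLoad target_sum_r set_sums one_r,
     ICopy target_r one_r,
     ICopy count_r sets_r,
     \<comment> \<open>\<open>select_pc\<close> = 22\<close>
     IJumpEq count_r zero_r selected_pc,
     RLoad value_r set_sums count_r,
     RJumpLess target_sum_r value_r compare_max_pc,
     RCopy target_sum_r value_r,
     ICopy target_r count_r,
     \<comment> \<open>\<open>compare_max_pc\<close> = 27\<close>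
     ILoad flag_r in_index_set count_r,
     IJumpEq flag_r zero_r next_set_pc,
     RJumpLess value_r source_sum_r next_set_pc,
     RCopy source_sum_r value_r,
     ICopy source_r count_r,
     \<comment> \<open>\<open>next_set_pc\<close> = 32\<close>
     ISub count_r count_r one_r,
     Jump select_pc,
     \<comment> \<open>\<open>selected_pc\<close> = 34\<close>
     IJumpEq source_r one_r gap_pc,
     \<comment> \<open>\<open>discard_pc\<close> = 35\<close>
     IStore in_index_set source_r zero_r,
     ISub card_r card_r one_r,
     Jump main_pc,
     \<comment> \<open>\<open>gap_pc\<close> = 38\<close>
     RSub gap_r source_sum_r target_sum_r,
     \<comment> \<open>\<open>scan_pc\<close> = 39\<close>
     IJumpEq pointer_r zero_r discard_pc,
     ISub pointer_r pointer_r one_r,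
     RLoad value_r item_values pointer_r,
     RJumpLess value_r gap_r move_pc,
     Jump scan_pc,
     \<comment> \<open>\<open>move_pc\<close> = 44\<close>
     IStore set_of_item pointer_r target_r,
     RSub source_sum_r source_sum_r value_r,
     RStore set_sums one_r source_sum_r,
     RAdd target_sum_r target_sum_r value_r,
     RStore set_sums target_r target_sum_r,
     Jump main_pc]"

lemma length_prog [simp]: "length (prog K) = 50"
  by (simp add: prog_def)

lemmas prog_nth [simp] =
  prog_def [THEN arg_cong, of "\<lambda>P. P ! 0" for K]
  prog_def [THEN arg_cong, of "\<lambda>P. P ! Suc 0" for K]
  prog_def [THEN arg_cong, of "\<lambda>P. P ! numeral n" for n K]

lemmas [simp] =
  next_pc_def set_ireg_def set_rreg_def set_iarr_def set_rarr_def jump_if_def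

lemma item_loop:
  assumes "pc c = item_loop_pc" "ireg c one_r = 1" "ireg c zero_r = 0" "ireg c count_r = k"
  shows "run (prog K) (6 * k + 1) c = c\<lparr>
    pc := store_sum_pc,
    ireg := (ireg c)(count_r := 0),
    rreg := (rreg c)(source_sum_r := rreg c source_sum_r + (\<Sum>q<k. rarr c item_values q),
                     value_r := if k = 0 then rreg c value_r else rarr c item_values 0),
    iarr := (iarr c)(set_of_item := \<lambda>q. if q < k then 1 else iarr c set_of_item q)\<rparr>"
  using assms
proof (induction k arbitrary: c)
  case 0
  then show ?case
    by (auto simp: fun_eq_iff intro!: config.equality)
next
  case (Suc k)
  have "run (prog K) (6 * Suc k + 1) c = run (prog K) (6 * k + 1) (run (prog K) 6 c)"
    by (simp flip: run_add add: algebra_simps)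
  also have "run (prog K) 6 c = c\<lparr>
    ireg := (ireg c)(count_r := k),
    rreg := (rreg c)(source_sum_r := rreg c source_sum_r + rarr c item_values k,
                     value_r := rarr c item_values k),
    iarr := (iarr c)(set_of_item := (iarr c set_of_item)(k := 1))\<rparr>"
    using Suc.prems by (auto simp: fun_eq_iff intro!: config.equality)
  finally show ?case
    using Suc.prems by (auto simp: Suc.IH fun_eq_iff intro!: config.equality)
qed

lemma index_loop:
  assumes "pc c = index_loop_pc" "ireg c one_r = 1" "ireg c zero_r = 0" "ireg c count_r = k"
  shows "run (prog K) (4 * k + 1) c = c\<lparr>
    pc := store_card_pc,
    ireg := (ireg c)(count_r := 0),
    iarr := (iarr c)(in_index_set := \<lambda>l. if l \<in> {1..k} then 1 else iarr c in_index_set l)\<rparr>"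
  using assms
proof (induction k arbitrary: c)
  case 0
  then show ?case
    by (auto simp: fun_eq_iff intro!: config.equality)
next
  case (Suc k)
  have "run (prog K) (4 * Suc k + 1) c = run (prog K) (4 * k + 1) (run (prog K) 4 c)"
    by (simp flip: run_add add: algebra_simps)
  also have "run (prog K) 4 c = c\<lparr>
    ireg := (ireg c)(count_r := k),
    iarr := (iarr c)(in_index_set := (iarr c in_index_set)(Suc k := 1))\<rparr>"
    using Suc.prems by (auto simp: fun_eq_iff intro!: config.equality)
  finally show ?case
    using Suc.prems by (auto simp: Suc.IH fun_eq_iff intro!: config.equality)
qed

section \<open>Initialisation, selection and scanning\<close>

definition layout ::
  "nat \<Rightarrow> real list \<Rightarrow> (nat \<Rightarrow> nat) \<Rightarrow> nat \<Rightarrow> nat set \<Rightarrow> config \<Rightarrow> bool" where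
  "layout K xs a p I c \<longleftrightarrow>
     ireg c one_r = 1 \<and> ireg c zero_r = 0 \<and> ireg c sets_r = K \<and>
     ireg c pointer_r = p \<and> ireg c card_r = card I \<and> iarr c set_of_item = a \<and>
     (\<forall>q<length xs. rarr c item_values q = xs ! q) \<and>
     (\<forall>k\<in>{1..K}. iarr c in_index_set k = (if k \<in> I then 1 else 0)) \<and>
     (\<forall>k\<in>{1..K}. rarr c set_sums k = load xs a k)"

lemma layout_update_pc [simp]: "layout K xs a p I (c\<lparr>pc := l\<rparr>) \<longleftrightarrow> layout K xs a p I c"
  by (simp add: layout_def)

lemma layout_represents:
  assumes "layout K xs a p I c" "frontier K xs a p"
  shows "represents K xs c (items xs a, I)"
proof -
  have "items xs a k = image_mset (\<lambda>p. xs ! p) (mset_set {p. p < length xs \<and> a p = k})" for k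
    by (simp add: items_def positions_def)
  then show ?thesis
    using assms by (simp add: layout_def represents_def frontier_def)
qed

lemma layout_init:
  fixes K :: nat and xs :: "real list"
  assumes "1 \<le> K"
  defines "c \<equiv> run (prog K) (6 * length xs + 4 * K + 9) (init_config xs)"
  shows "pc c = main_pc" "layout K xs (initial_assignment xs) (length xs) {1..K} c"
proof -
  let ?N = "length xs"
  have "6 * ?N + 4 * K + 9 = 4 + ((6 * ?N + 1) + (2 + ((4 * K + 1) + 1)))"
    by simp
  then have c: "c = run (prog K) 1 (run (prog K) (4 * K + 1) (run (prog K) 2
      (run (prog K) (6 * ?N + 1) (run (prog K) 4 (init_config xs)))))"
    unfolding c_def by (simp only: run_add)
  have "load xs (initial_assignment xs) = (\<lambda>k. if k = 1 then \<Sum>q<?N. xs ! q else 0)"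
    by (rule load_const) (simp add: initial_assignment_def)
  then show "pc c = main_pc" "layout K xs (initial_assignment xs) ?N {1..K} c"
    using assms(1) unfolding c
    by (simp_all add: init_config_def item_loop index_loop layout_def initial_assignment_def
        fun_eq_iff flip: numeral_2_eq_2)
qed

definition suffix_min :: "nat \<Rightarrow> (nat \<Rightarrow> real) \<Rightarrow> nat \<Rightarrow> nat \<Rightarrow> real \<Rightarrow> bool" where
  "suffix_min K S k j m \<longleftrightarrow> j \<in> {1..K} \<and> m = S j \<and> (\<forall>l\<in>{1..K}. k < l \<longrightarrow> m \<le> S l)"

text \<open>The sums are nonnegative, so \<open>- 1\<close> can stand for the maximum of no sums at all.\<close>

definition suffix_max :: "nat set \<Rightarrow> (nat \<Rightarrow> real) \<Rightarrow> nat \<Rightarrow> nat \<Rightarrow> real \<Rightarrow> bool" where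
  "suffix_max I S k i m \<longleftrightarrow> (m = - 1 \<or> i \<in> I \<and> m = S i) \<and> (\<forall>l\<in>I. k < l \<longrightarrow> S l \<le> m)"

lemma suffix_min_keep:
  assumes "suffix_min K S (Suc k) j m" "m \<le> S (Suc k)"
  shows "suffix_min K S k j m"
  using assms by (auto simp: suffix_min_def dest: Suc_lessI)

lemma suffix_min_replace:
  assumes "suffix_min K S (Suc k) j m" "S (Suc k) \<le> m" "Suc k \<le> K"
  shows "suffix_min K S k (Suc k) (S (Suc k))"
  using assms by (force simp: suffix_min_def dest: Suc_lessI)

lemma suffix_max_keep:
  assumes "suffix_max I S (Suc k) i m" "Suc k \<in> I \<Longrightarrow> S (Suc k) \<le> m"
  shows "suffix_max I S k i m"
  using assms by (auto simp: suffix_max_def dest: Suc_lessI)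

lemma suffix_max_replace:
  assumes "suffix_max I S (Suc k) i m" "m \<le> S (Suc k)" "Suc k \<in> I"
  shows "suffix_max I S k (Suc k) (S (Suc k))"
  using assms by (force simp: suffix_max_def dest: Suc_lessI)

lemma suffix_min_0_imp_smallest:
  assumes "suffix_min K S 0 j m"
  shows "smallest S {1..K} j" "m = S j"
  using assms by (auto simp: suffix_min_def is_arg_min_linorder)

lemma suffix_max_0_imp_largest:
  assumes "suffix_max I S 0 i m" "I \<subseteq> {1..K}" "I \<noteq> {}" "\<And>k. 0 \<le> S k"
  shows "largest S I i" "m = S i"
proof -
  have le: "S l \<le> m" if "l \<in> I" for l
    using that assms(1,2) by (force simp: suffix_max_def)
  obtain l where "l \<in> I"
    using assms(3) by blast
  then have "m \<noteq> - 1"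
    using le[of l] assms(4)[of l] by linarith
  then show "largest S I i" "m = S i"
    using assms(1) le by (auto simp: suffix_max_def is_arg_max_linorder)
qed

definition selecting ::
  "nat \<Rightarrow> real list \<Rightarrow> (nat \<Rightarrow> nat) \<Rightarrow> nat \<Rightarrow> nat set \<Rightarrow> nat \<Rightarrow> config \<Rightarrow> bool" where
  "selecting K xs a p I k c \<longleftrightarrow>
     layout K xs a p I c \<and> ireg c count_r = k \<and>
     suffix_min K (load xs a) k (ireg c target_r) (rreg c target_sum_r) \<and>
     suffix_max I (load xs a) k (ireg c source_r) (rreg c source_sum_r)"

definition selected ::
  "nat \<Rightarrow> real list \<Rightarrow> (nat \<Rightarrow> nat) \<Rightarrow> nat \<Rightarrow> nat set \<Rightarrow> config \<Rightarrow> bool" where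
  "selected K xs a p I c \<longleftrightarrow>
     layout K xs a p I c \<and>
     largest (load xs a) I (ireg c source_r) \<and> smallest (load xs a) {1..K} (ireg c target_r) \<and>
     rreg c source_sum_r = load xs a (ireg c source_r) \<and>
     rreg c target_sum_r = load xs a (ireg c target_r)"

lemma selecting_update_pc [simp]:
  "selecting K xs a p I k (c\<lparr>pc := l\<rparr>) \<longleftrightarrow> selecting K xs a p I k c"
  by (simp add: selecting_def)

lemma selected_update_pc [simp]:
  "selected K xs a p I (c\<lparr>pc := l\<rparr>) \<longleftrightarrow> selected K xs a p I c"
  by (simp add: selected_def)

lemma selecting_0_imp_selected:
  assumes "selecting K xs a p I 0 c" "I \<subseteq> {1..K}" "I \<noteq> {}" "\<And>k. 0 \<le> load xs a k"
  shows "selected K xs a p I c"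
proof -
  have "suffix_min K (load xs a) 0 (ireg c target_r) (rreg c target_sum_r)"
    and "suffix_max I (load xs a) 0 (ireg c source_r) (rreg c source_sum_r)"
    using assms(1) by (simp_all add: selecting_def)
  from suffix_min_0_imp_smallest[OF this(1)] suffix_max_0_imp_largest[OF this(2) assms(2-4)]
  show ?thesis
    using assms(1) by (simp add: selecting_def selected_def)
qed

lemma select_min_block:
  assumes "pc c = select_pc" "selecting K xs a p I (Suc k) c" "Suc k \<le> K"
  shows "\<exists>t c'. run (prog K) t c = c' \<and> t \<le> 5 \<and> pc c' = compare_max_pc \<and>
    layout K xs a p I c' \<and> ireg c' count_r = Suc k \<and> rreg c' value_r = load xs a (Suc k) \<and>
    suffix_min K (load xs a) k (ireg c' target_r) (rreg c' target_sum_r) \<and>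
    suffix_max I (load xs a) (Suc k) (ireg c' source_r) (rreg c' source_sum_r)"
proof -
  have [simp]: "pc c = select_pc" "ireg c zero_r = 0" "ireg c count_r = Suc k"
    "rarr c set_sums (Suc k) = load xs a (Suc k)"
    using assms by (simp_all add: selecting_def layout_def)
  have suffix_min: "suffix_min K (load xs a) (Suc k) (ireg c target_r) (rreg c target_sum_r)"
    using assms(2) by (simp add: selecting_def)
  show ?thesis
  proof (cases "rreg c target_sum_r < load xs a (Suc k)")
    case True
    then have "run (prog K) 3 c =
      c\<lparr>pc := compare_max_pc, rreg := (rreg c)(value_r := load xs a (Suc k))\<rparr>"
      by simp
    then show ?thesis
      using assms(2) suffix_min_keep[OF suffix_min] True
      by (intro exI[of _ 3]) (simp add: selecting_def layout_def)
  next
    case False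
    then have "run (prog K) 5 c =
      c\<lparr>pc := compare_max_pc, ireg := (ireg c)(target_r := Suc k),
        rreg := (rreg c)(value_r := load xs a (Suc k), target_sum_r := load xs a (Suc k))\<rparr>"
      by simp
    then show ?thesis
      using assms(2) suffix_min_replace[OF suffix_min _ assms(3)] False
      by (intro exI[of _ 5]) (simp add: selecting_def layout_def)
  qed
qed

lemma select_max_block:
  assumes "pc c = compare_max_pc" "layout K xs a p I c" "ireg c count_r = Suc k" "Suc k \<le> K"
    and "rreg c value_r = load xs a (Suc k)"
    and suffix_min: "suffix_min K (load xs a) k (ireg c target_r) (rreg c target_sum_r)"
    and suffix_max: "suffix_max I (load xs a) (Suc k) (ireg c source_r) (rreg c source_sum_r)"
  shows "\<exists>t c'. run (prog K) t c = c' \<and> t \<le> 7 \<and> pc c' = select_pc \<and> selecting K xs a p I k c'"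
proof -
  have [simp]: "pc c = compare_max_pc" "ireg c one_r = 1" "ireg c zero_r = 0"
    "ireg c count_r = Suc k" "rreg c value_r = load xs a (Suc k)"
    "iarr c in_index_set (Suc k) = (if Suc k \<in> I then 1 else 0)"
    using assms by (simp_all add: layout_def)
  consider "Suc k \<notin> I" | "Suc k \<in> I" "load xs a (Suc k) < rreg c source_sum_r"
    | "Suc k \<in> I" "rreg c source_sum_r \<le> load xs a (Suc k)"
    by fastforce
  then show ?thesis
  proof cases
    case 1
    then have "run (prog K) 4 c = c\<lparr>pc := select_pc, ireg := (ireg c)(flag_r := 0, count_r := k)\<rparr>"
      by simp
    then show ?thesis
      using assms(2) suffix_min suffix_max_keep[OF suffix_max] 1
      by (intro exI[of _ 4]) (simp add: selecting_def layout_def)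
  next
    case 2
    then have "run (prog K) 5 c = c\<lparr>pc := select_pc, ireg := (ireg c)(flag_r := 1, count_r := k)\<rparr>"
      by simp
    then show ?thesis
      using assms(2) suffix_min suffix_max_keep[OF suffix_max] 2
      by (intro exI[of _ 5]) (simp add: selecting_def layout_def)
  next
    case 3
    then have "run (prog K) 7 c =
      c\<lparr>pc := select_pc, ireg := (ireg c)(flag_r := 1, source_r := Suc k, count_r := k),
        rreg := (rreg c)(source_sum_r := load xs a (Suc k))\<rparr>"
      by simp
    then show ?thesis
      using assms(2) suffix_min suffix_max_replace[OF suffix_max] 3
      by (intro exI[of _ 7]) (simp add: selecting_def layout_def)
  qed
qed

lemma select_loop:
  assumes "pc c = select_pc" "selecting K xs a p I k c" "k \<le> K"
  shows "\<exists>t c'. run (prog K) t c = c' \<and> t \<le> 12 * k + 1 \<and> pc c' = selected_pc \<and>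
    selecting K xs a p I 0 c'"
  using assms
proof (induction k arbitrary: c)
  case 0
  then have "run (prog K) 1 c = c\<lparr>pc := selected_pc\<rparr>"
    by (simp add: selecting_def layout_def)
  then show ?case
    using 0 by (intro exI[of _ 1]) simp
next
  case (Suc k)
  obtain t1 c1 where c1: "run (prog K) t1 c = c1" "t1 \<le> 5" "pc c1 = compare_max_pc"
    "layout K xs a p I c1" "ireg c1 count_r = Suc k" "rreg c1 value_r = load xs a (Suc k)"
    "suffix_min K (load xs a) k (ireg c1 target_r) (rreg c1 target_sum_r)"
    "suffix_max I (load xs a) (Suc k) (ireg c1 source_r) (rreg c1 source_sum_r)"
    using select_min_block[OF Suc.prems] by blast
  then obtain t2 c2 where c2: "run (prog K) t2 c1 = c2" "t2 \<le> 7" "pc c2 = select_pc"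
    "selecting K xs a p I k c2"
    using select_max_block[of c1] Suc.prems(3) by blast
  then obtain t3 c3 where c3: "run (prog K) t3 c2 = c3" "t3 \<le> 12 * k + 1" "pc c3 = selected_pc"
    "selecting K xs a p I 0 c3"
    using Suc.IH[of c2] Suc.prems(3) by auto
  then show ?case
    using c1(1,2) c2(1,2) by (intro exI[of _ "t1 + (t2 + t3)"] exI[of _ c3]) (simp add: run_add)
qed

lemma select_block:
  assumes "pc c = main_pc" "layout K xs a p I c" "I \<subseteq> {1..K}" "I \<noteq> {}" "card I \<noteq> 1"
    and nonneg: "\<And>k. 0 \<le> load xs a k"
  shows "\<exists>t c'. run (prog K) t c = c' \<and> t \<le> 12 * K + 6 \<and> pc c' = selected_pc \<and>
    selected K xs a p I c'"
proof -
  have "1 \<le> K"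
    using assms(3,4) by auto
  then have c1: "run (prog K) 5 c = c\<lparr>pc := select_pc,
      ireg := (ireg c)(target_r := 1, count_r := K),
      rreg := (rreg c)(source_sum_r := - 1, target_sum_r := load xs a 1)\<rparr>" (is "_ = ?c1")
    using assms(1,2,5) by (simp add: layout_def)
  have "selecting K xs a p I K ?c1"
    using assms(2,3) \<open>1 \<le> K\<close> by (force simp: selecting_def layout_def suffix_min_def suffix_max_def)
  from select_loop[OF _ this order_refl] obtain t c' where
    "run (prog K) t ?c1 = c'" "t \<le> 12 * K + 1" "pc c' = selected_pc" "selecting K xs a p I 0 c'"
    by auto
  then show ?thesis
    using c1 selecting_0_imp_selected[of K xs a p I c'] assms(3,4) nonneg
    by (intro exI[of _ "5 + t"] exI[of _ c']) (simp add: run_add)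
qed

lemma discard_block:
  assumes "pc c = discard_pc" "layout K xs a p I c" "ireg c source_r \<in> I" "finite I"
  shows "pc (run (prog K) 3 c) = main_pc"
    "layout K xs a p (I - {ireg c source_r}) (run (prog K) 3 c)"
  using assms by (auto simp: layout_def)

lemma move_block:
  assumes "pc c = move_pc" "selected K xs a p I c" "ireg c source_r = 1"
    and "rreg c value_r = xs ! p" "p < length xs" "a p = 1" "ireg c target_r \<noteq> 1"
  shows "pc (run (prog K) 6 c) = main_pc"
    "layout K xs (a(p := ireg c target_r)) p I (run (prog K) 6 c)"
  using assms by (auto simp: selected_def layout_def load_update)

definition scanned ::
  "nat \<Rightarrow> real list \<Rightarrow> (nat \<Rightarrow> nat) \<Rightarrow> nat \<Rightarrow> nat \<Rightarrow> nat set \<Rightarrow> config \<Rightarrow> bool" where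
  "scanned K xs a p p' I c \<longleftrightarrow>
     selected K xs a p' I c \<and> ireg c source_r = 1 \<and>
     (pc c = discard_pc \<and> p' = 0 \<and> frontier K xs a 0 \<or>
      pc c = move_pc \<and> p' < p \<and> frontier K xs a (Suc p') \<and> rreg c value_r = xs ! p' \<and>
      xs ! p' < load xs a 1 - load xs a (ireg c target_r))"

lemma scan_hit_block:
  assumes "pc c = scan_pc" "layout K xs a (Suc p) I c" "p < length xs" "xs ! p < rreg c gap_r"
  shows "run (prog K) 4 c =
    c\<lparr>pc := move_pc, ireg := (ireg c)(pointer_r := p), rreg := (rreg c)(value_r := xs ! p)\<rparr>"
  using assms by (simp add: layout_def)

lemma scan_miss_block:
  assumes "pc c = scan_pc" "layout K xs a (Suc p) I c" "p < length xs" "rreg c gap_r \<le> xs ! p"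
  shows "run (prog K) 5 c =
    c\<lparr>ireg := (ireg c)(pointer_r := p), rreg := (rreg c)(value_r := xs ! p)\<rparr>"
  using assms by (simp add: layout_def)

lemma scan_loop:
  assumes "pc c = scan_pc" "selected K xs a p I c" "ireg c source_r = 1" "frontier K xs a p"
    and "rreg c gap_r = load xs a 1 - load xs a (ireg c target_r)"
  shows "\<exists>t c' p'. run (prog K) t c = c' \<and> t + 5 * p' \<le> 5 * p + 1 \<and> scanned K xs a p p' I c'"
  using assms
proof (induction p arbitrary: c)
  case 0
  then have "run (prog K) 1 c = c\<lparr>pc := discard_pc\<rparr>"
    by (simp add: selected_def layout_def)
  then show ?case
    using 0 by (intro exI[of _ 1] exI[of _ 0]) (simp add: scanned_def)
next
  case (Suc p)
  have p: "p < length xs" "a p = 1"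
    using Suc.prems(4) by (simp_all add: frontier_def)
  have layout: "layout K xs a (Suc p) I c"
    using Suc.prems(2) by (simp add: selected_def)
  show ?case
  proof (cases "xs ! p < rreg c gap_r")
    case True
    then show ?thesis
      using Suc.prems scan_hit_block[OF Suc.prems(1) layout p(1)]
      by (intro exI[of _ 4] exI[of _ p]) (simp add: scanned_def selected_def layout_def)
  next
    case False
    let ?c1 = "c\<lparr>ireg := (ireg c)(pointer_r := p), rreg := (rreg c)(value_r := xs ! p)\<rparr>"
    have c1: "run (prog K) 5 c = ?c1"
      using scan_miss_block[OF Suc.prems(1) layout p(1)] False by simp
    have "smallest (load xs a) {1..K} (ireg c target_r)"
      using Suc.prems(2) by (simp add: selected_def)
    then have "settled K xs a p"
      using False Suc.prems(5) p(2) by (simp add: settled_iff_smallest)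
    with Suc.prems(4) have "frontier K xs a p"
      by (rule frontier_skip)
    then obtain t c' p' where "run (prog K) t ?c1 = c'" "t + 5 * p' \<le> 5 * p + 1"
      "scanned K xs a p p' I c'"
      using Suc.IH[of ?c1] Suc.prems by (auto simp: selected_def layout_def)
    moreover from this have "scanned K xs a (Suc p) p' I c'"
      by (auto simp: scanned_def)
    ultimately show ?thesis
      using c1 by (intro exI[of _ "5 + t"] exI[of _ c'] exI[of _ p']) (simp add: run_add)
  qed
qed

section \<open>The main loop\<close>

definition loop_inv ::
  "nat \<Rightarrow> real list \<Rightarrow> (nat \<Rightarrow> nat) \<Rightarrow> nat \<Rightarrow> nat set \<Rightarrow> config \<Rightarrow> bool" where
  "loop_inv K xs a p I c \<longleftrightarrow>
     pc c = main_pc \<and> layout K xs a p I c \<and> frontier K xs a p \<and> I \<subseteq> {1..K} \<and> I \<noteq> {}"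

lemma loop_inv_init:
  assumes "1 \<le> K"
  shows "loop_inv K xs (initial_assignment xs) (length xs) {1..K}
    (run (prog K) (6 * length xs + 4 * K + 9) (init_config xs))"
  using assms layout_init[OF assms, of xs]
  by (simp add: loop_inv_def frontier_length initial_assignment_def)

lemma loop_inv_halts:
  assumes "loop_inv K xs a p I c" "card I = 1"
  shows "represents K xs (run (prog K) 1 c) (items xs a, I)" "halted (prog K) (run (prog K) 1 c)"
proof -
  have "run (prog K) 1 c = c\<lparr>pc := halt_pc\<rparr>"
    using assms by (simp add: loop_inv_def layout_def)
  then show "represents K xs (run (prog K) 1 c) (items xs a, I)"
    "halted (prog K) (run (prog K) 1 c)"
    using assms(1) layout_represents[of K xs a p I "c\<lparr>pc := halt_pc\<rparr>"]
    by (simp_all add: loop_inv_def halted_def)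
qed

lemma amortized_cost_le:
  fixes a b t m m' :: nat
  assumes "t + b * m' \<le> a + b * m" "m' < m"
  shows "t + (a + b) * m' \<le> (a + b) * m"
proof -
  have "t + (a + b) * m' = t + b * m' + a * m'"
    by (simp add: algebra_simps)
  also have "\<dots> \<le> b * m + a * Suc m'"
    using assms(1) by simp
  also have "\<dots> \<le> b * m + a * m"
    using assms(2) by (intro add_left_mono mult_le_mono2) simp
  finally show ?thesis
    by (simp add: algebra_simps)
qed

text \<open>
  Passing a position with the pointer costs 5 instructions, and everything else in one iteration at
  most \<open>12 * K + 15\<close>.  Each iteration lowers the pointer or \<open>card I\<close>, which pays for both.
\<close>

definition potential :: "nat \<Rightarrow> config \<Rightarrow> nat" where
  "potential K c = (12 * K + 15 + 5) * (ireg c pointer_r + ireg c card_r)"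

lemma potential_loop_inv:
  assumes "loop_inv K xs a p I c"
  shows "potential K c = (12 * K + 15 + 5) * (p + card I)"
  using assms by (simp add: potential_def loop_inv_def layout_def)

context sorted_input
begin

lemma load_input_nonneg: "0 \<le> load xs a k"
  by (simp add: load_nonneg pos less_imp_le)

lemma discard_iteration:
  assumes "pc c = discard_pc" and sel: "selected K xs a p I c" and frontier: "frontier K xs a p"
    and I: "I \<subseteq> {1..K}" "card I \<noteq> 1"
    and settled: "\<forall>q\<in>positions xs a (ireg c source_r). settled K xs a q"
  shows "\<exists>c' I'. run (prog K) 3 c = c' \<and> alg_step K (items xs a, I) (items xs a, I') \<and>
    loop_inv K xs a p I' c' \<and> card I' < card I"
proof -
  let ?i = "ireg c source_r"
  have i: "?i \<in> I"
    using sel by (simp add: selected_def is_arg_max_def)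
  have "finite I"
    using I(1) by (rule finite_subset) simp
  then have "I - {?i} \<noteq> {}" "card (I - {?i}) < card I"
    using i I(2) card_Diff1_less[of I ?i] by (auto simp: card_Diff_singleton subset_singleton_iff)
  moreover have "alg_step K (items xs a, I) (items xs a, I - {?i})"
    using sel settled I
    by (intro alg_step_discard[where j = "ireg c target_r"]) (simp_all add: selected_def)
  moreover have "layout K xs a p I c"
    using sel by (simp add: selected_def)
  ultimately show ?thesis
    using discard_block[of c K xs a p I] assms(1) i \<open>finite I\<close> frontier I(1)
    by (intro exI[of _ "run (prog K) 3 c"] exI[of _ "I - {?i}"]) (auto simp: loop_inv_def)
qed

lemma move_iteration:
  assumes "pc c = move_pc" and sel: "selected K xs a p I c" and frontier: "frontier K xs a (Suc p)"
    and I: "I \<subseteq> {1..K}" "card I \<noteq> 1" and "ireg c source_r = 1" "rreg c value_r = xs ! p"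
    and gap: "xs ! p < load xs a 1 - load xs a (ireg c target_r)"
  shows "\<exists>c' a'. run (prog K) 6 c = c' \<and> alg_step K (items xs a, I) (items xs a', I) \<and>
    loop_inv K xs a' p I c'"
proof -
  let ?j = "ireg c target_r"
  have p: "p < length xs" "a p = 1"
    using frontier by (simp_all add: frontier_def)
  have "?j \<noteq> 1"
    using gap nth_pos[OF p(1)] by auto
  have sel': "largest (load xs a) I 1" "smallest (load xs a) {1..K} ?j"
    using sel assms(6) by (simp_all add: selected_def)
  have "I \<noteq> {}"
    using sel'(1) by (auto simp: is_arg_max_def)
  moreover have "frontier K xs (a(p := ?j)) p"
    using frontier sel'(2) gap by (rule frontier_move)
  ultimately have "loop_inv K xs (a(p := ?j)) p I (run (prog K) 6 c)"
    using move_block[OF assms(1) sel assms(6,7) p \<open>?j \<noteq> 1\<close>] I(1) by (simp add: loop_inv_def)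
  moreover have "alg_step K (items xs a, I) (items xs (a(p := ?j)), I)"
    using I(2) sel' frontier gap by (rule alg_step_move)
  ultimately show ?thesis
    by blast
qed

lemma scan_iteration:
  assumes "pc c = scan_pc" "selected K xs a p I c" "ireg c source_r = 1" "frontier K xs a p"
    and "rreg c gap_r = load xs a 1 - load xs a (ireg c target_r)"
    and I: "I \<subseteq> {1..K}" "card I \<noteq> 1"
  shows "\<exists>t c' a' p' I'. run (prog K) t c = c' \<and>
    alg_step K (items xs a, I) (items xs a', I') \<and> loop_inv K xs a' p' I' c' \<and>
    p' + card I' < p + card I \<and> t + 5 * (p' + card I') \<le> 7 + 5 * (p + card I)"
proof -
  obtain t c1 p' where t: "run (prog K) t c = c1" "t + 5 * p' \<le> 5 * p + 1"
    and scanned: "scanned K xs a p p' I c1"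
    using scan_loop[OF assms(1-5)] by blast
  have c1: "selected K xs a p' I c1" "ireg c1 source_r = 1"
    using scanned by (simp_all add: scanned_def)
  consider (discard) "pc c1 = discard_pc" "p' = 0" "frontier K xs a 0"
    | (move) "pc c1 = move_pc" "p' < p" "frontier K xs a (Suc p')" "rreg c1 value_r = xs ! p'"
        "xs ! p' < load xs a 1 - load xs a (ireg c1 target_r)"
    using scanned unfolding scanned_def by blast
  then show ?thesis
  proof cases
    case discard
    then obtain c' I' where "run (prog K) 3 c1 = c'" "card I' < card I"
      "alg_step K (items xs a, I) (items xs a, I')" "loop_inv K xs a 0 I' c'"
      using discard_iteration[of c1 a 0 I] c1 I frontier_settled_0 by blast
    then show ?thesis
      using t \<open>p' = 0\<close> run_add[of "prog K" t 3 c]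
      by (intro exI[of _ "t + 3"] exI[of _ c'] exI[of _ a] exI[of _ 0] exI[of _ I']) simp
  next
    case move
    then obtain c' a' where "run (prog K) 6 c1 = c'"
      "alg_step K (items xs a, I) (items xs a', I)" "loop_inv K xs a' p' I c'"
      using move_iteration[of c1 a p' I] c1 I by blast
    then show ?thesis
      using t \<open>p' < p\<close> run_add[of "prog K" t 6 c]
      by (intro exI[of _ "t + 6"] exI[of _ c'] exI[of _ a'] exI[of _ p'] exI[of _ I]) simp
  qed
qed

lemma selected_iteration:
  assumes "pc c = selected_pc" "selected K xs a p I c" "frontier K xs a p"
    and I: "I \<subseteq> {1..K}" "card I \<noteq> 1"
  shows "\<exists>t c' a' p' I'. run (prog K) t c = c' \<and>
    alg_step K (items xs a, I) (items xs a', I') \<and> loop_inv K xs a' p' I' c' \<and>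
    p' + card I' < p + card I \<and> t + 5 * (p' + card I') \<le> 9 + 5 * (p + card I)"
proof (cases "ireg c source_r = 1")
  case False
  then have "run (prog K) 1 c = c\<lparr>pc := discard_pc\<rparr>"
    using assms(1,2) by (simp add: selected_def layout_def)
  moreover obtain c' I' where "run (prog K) 3 (c\<lparr>pc := discard_pc\<rparr>) = c'"
    "alg_step K (items xs a, I) (items xs a, I')" "loop_inv K xs a p I' c'" "card I' < card I"
    using discard_iteration[of "c\<lparr>pc := discard_pc\<rparr>" a p I] False assms(2-5)
      frontier_settled_other[OF assms(3)] by auto
  ultimately show ?thesis
    using run_add[of "prog K" 1 3 c]
    by (intro exI[of _ 4] exI[of _ c'] exI[of _ a] exI[of _ p] exI[of _ I']) simp
next
  case True
  then have c1: "run (prog K) 2 c = c\<lparr>pc := scan_pc,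
      rreg := (rreg c)(gap_r := rreg c source_sum_r - rreg c target_sum_r)\<rparr>" (is "_ = ?c1")
    using assms(1,2) by (simp add: selected_def layout_def)
  have "selected K xs a p I ?c1" "rreg ?c1 gap_r = load xs a 1 - load xs a (ireg ?c1 target_r)"
    using assms(2) True by (auto simp: selected_def layout_def)
  then obtain t c' a' p' I' where "run (prog K) t ?c1 = c'"
    "alg_step K (items xs a, I) (items xs a', I')" "loop_inv K xs a' p' I' c'"
    "p' + card I' < p + card I" "t + 5 * (p' + card I') \<le> 7 + 5 * (p + card I)"
    using scan_iteration[of ?c1 a p I] True assms(3) I by auto
  then show ?thesis
    using c1 run_add[of "prog K" 2 t c]
    by (intro exI[of _ "2 + t"] exI[of _ c'] exI[of _ a'] exI[of _ p'] exI[of _ I']) simp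
qed

lemma main_iteration:
  assumes "loop_inv K xs a p I c" "card I \<noteq> 1"
  shows "\<exists>t c' a' p' I'. run (prog K) t c = c' \<and>
    alg_step K (items xs a, I) (items xs a', I') \<and> loop_inv K xs a' p' I' c' \<and>
    p' + card I' < p + card I \<and> t + 5 * (p' + card I') \<le> 12 * K + 15 + 5 * (p + card I)"
proof -
  have inv: "frontier K xs a p" "I \<subseteq> {1..K}"
    using assms(1) by (simp_all add: loop_inv_def)
  obtain t1 c1 where c1: "run (prog K) t1 c = c1" "t1 \<le> 12 * K + 6"
    and selected: "pc c1 = selected_pc" "selected K xs a p I c1"
    using select_block[of c K xs a p I] assms load_input_nonneg by (auto simp: loop_inv_def)
  obtain t2 c' a' p' I' where "run (prog K) t2 c1 = c'"
    "alg_step K (items xs a, I) (items xs a', I')" "loop_inv K xs a' p' I' c'"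
    "p' + card I' < p + card I" "t2 + 5 * (p' + card I') \<le> 9 + 5 * (p + card I)"
    using selected_iteration[OF selected inv assms(2)] by blast
  then show ?thesis
    using c1
    by (intro exI[of _ "t1 + t2"] exI[of _ c'] exI[of _ a'] exI[of _ p'] exI[of _ I'])
      (simp add: run_add)
qed

lemma main_iteration_potential:
  assumes inv: "loop_inv K xs a p I c" and "card I \<noteq> 1"
  shows "\<exists>t c' a' p' I'. run (prog K) t c = c' \<and>
    alg_step K (items xs a, I) (items xs a', I') \<and> loop_inv K xs a' p' I' c' \<and>
    potential K c' < potential K c \<and> t + potential K c' \<le> potential K c"
proof -
  obtain t c' a' p' I' where run: "run (prog K) t c = c'"
    "alg_step K (items xs a, I) (items xs a', I')" and inv': "loop_inv K xs a' p' I' c'"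
    and less: "p' + card I' < p + card I"
    and time: "t + 5 * (p' + card I') \<le> 12 * K + 15 + 5 * (p + card I)"
    using main_iteration[OF assms] by blast
  note potential = potential_loop_inv[OF inv] potential_loop_inv[OF inv']
  have "t + potential K c' \<le> potential K c"
    using amortized_cost_le[OF time less] by (simp add: potential)
  moreover have "potential K c' < potential K c"
    using less by (simp only: potential mult_less_mono2)
  ultimately show ?thesis
    using run inv' by blast
qed

lemma completes_within_main_loop:
  assumes "loop_inv K xs a p I c"
  shows "completes_within (prog K) K xs (items xs a, I) c (potential K c)"
proof -
  define R where "R s c \<longleftrightarrow> (\<exists>a p I. s = (items xs a, I) \<and> loop_inv K xs a p I c)"
    for s :: state and c :: config
  show ?thesis
  proof (rule completes_within_potential[where R = R])
    fix s c
    assume "R s c"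
    then obtain a p I where s: "s = (items xs a, I)" and inv: "loop_inv K xs a p I c"
      by (auto simp: R_def)
    show "represents K xs c s"
      using inv layout_represents by (auto simp: s loop_inv_def)
    show "\<exists>t\<le>potential K c.
        represents K xs (run (prog K) t c) s \<and> halted (prog K) (run (prog K) t c)"
      if "stopped s"
      using loop_inv_halts[OF inv] that
      by (intro exI[of _ 1]) (simp add: s stopped_def potential_loop_inv[OF inv] algebra_simps)
    show "\<exists>t c' s'. run (prog K) t c = c' \<and> alg_step K s s' \<and> R s' c' \<and>
        potential K c' < potential K c \<and> t + potential K c' \<le> potential K c"
      if "\<not> stopped s"
      using main_iteration_potential[OF inv] that unfolding R_def s stopped_def snd_conv by blast
  qed (use assms in \<open>auto simp: R_def\<close>)
qed

lemma implements_within_prog: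
  assumes "1 \<le> K"
  shows "implements_within (prog K) K xs
    (6 * length xs + 4 * K + 9 + (12 * K + 15 + 5) * (length xs + K))"
proof -
  note inv = loop_inv_init[OF assms, of xs]
  have "(items xs (initial_assignment xs), {1..K}) = init_state K xs"
    by (simp add: init_state_def items_const[where i = 1] initial_assignment_def)
  then show ?thesis
    using completes_within_delay[OF completes_within_main_loop[OF inv]]
    by (simp add: implements_within_iff_completes_within potential_loop_inv[OF inv])
qed

end

lemma linear_bigo_linearithmic:
  fixes a b :: nat
  shows "(\<lambda>n. real (a + b * n)) \<in> O(\<lambda>n. real n * ln (real n))"
proof -
  let ?g = "\<lambda>n. real n * ln (real n)"
  have scale: "(\<lambda>n. k * f n) \<in> O(?g)" if "f \<in> O(?g)" for k :: real and f
    using landau_o.big.mult[OF bigo_const that] by simp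
  have "(\<lambda>n. 1) \<in> O(?g)" "(\<lambda>n. real n) \<in> O(?g)"
    by real_asymp+
  then have "(\<lambda>n. real a * 1 + real b * real n) \<in> O(?g)"
    by (intro sum_in_bigo(1) scale)
  then show ?thesis
    by simp
qed

theorem theorem2:
  fixes K :: nat
  assumes "K \<ge> 2"
  shows "\<exists>(P :: program) (T :: nat \<Rightarrow> nat).
           (\<forall>xs :: real list. sorted xs \<and> (\<forall>x \<in> set xs. 0 < x) \<longrightarrow>
              implements_within P K xs (T (length xs))) \<and>
           (\<lambda>N. real (T N)) \<in> O(\<lambda>N. real N * ln (real N))"
proof (intro exI conjI allI impI)
  let ?T = "\<lambda>N. 6 * N + 4 * K + 9 + (12 * K + 15 + 5) * (N + K)"
  show "implements_within (prog K) K xs (?T (length xs))"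
    if "sorted xs \<and> (\<forall>x \<in> set xs. 0 < x)" for xs
  proof -
    interpret sorted_input K xs
      using that by unfold_locales auto
    show ?thesis
      using assms by (intro implements_within_prog) simp
  qed
  have "?T N = (4 * K + 9 + (12 * K + 20) * K) + (12 * K + 26) * N" for N
    by (simp add: algebra_simps)
  then show "(\<lambda>N. real (?T N)) \<in> O(\<lambda>N. real N * ln (real N))"
    by (simp only: linear_bigo_linearithmic)
qed

end
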